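(* Let $n$ and $k$ be positive integers. The equation $(k!)^{n!}-k^n=(n!)^{k!}-n^k$ holds if and only if $k=n$ or $(k,n)\in\{(1,2),(2,1)\}$. *)

theory Defs
  imports Main
begin

end

theory Submission
  imports Defs Complex_Main
begin

text \<open>
  By symmetry let \<open>k < n\<close>; the case \<open>k = 1\<close> reduces to \<open>n! = n\<close>. For \<open>k \<ge> 2\<close> put \<open>a = k!\<close> and
  \<open>b = n!\<close>, so \<open>b \<ge> 3a\<close>. Then \<open>b^a \<le> (3/4) a^b\<close>, by induction on \<open>b\<close>, and
  \<open>k^n \<le> a^(b - 2) \<le> (1/4) a^b\<close>, hence \<open>a^b - b^a \<ge> k^n > k^n - n^k\<close>.
\<close>

text \<open>Bernoulli: \<open>(1 - 1 / (b + 1)) ^ a\<close> is at least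
  \<open>1 - a / (b + 1)\<close>, hence at least \<open>1 / 2\<close>.\<close>

lemma power_Suc_base_le_double:
  fixes a b :: nat
  assumes "2 * a \<le> Suc b"
  shows "Suc b ^ a \<le> 2 * b ^ a"
proof -
  have "1 / 2 \<le> 1 + real a * (- 1 / real (Suc b))"
    using assms by (simp add: field_simps)
  also have "\<dots> \<le> (1 + (- 1 / real (Suc b))) ^ a"
    by (rule Bernoulli_inequality) (simp add: field_simps)
  also have "1 + (- 1 / real (Suc b)) = real b / real (Suc b)"
    by (simp add: field_simps)
  finally have "real (Suc b) ^ a \<le> 2 * real b ^ a"
    by (simp add: power_divide field_simps del: of_nat_Suc)
  then have "real (Suc b ^ a) \<le> real (2 * b ^ a)"
    by (simp del: of_nat_Suc)
  then show ?thesis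
    by (simp only: of_nat_le_iff)
qed

text \<open>Raising \<open>b\<close> by one at most doubles \<open>b ^ a\<close> but multiplies
  \<open>a ^ b\<close> by \<open>a\<close>, which is at least 2.\<close>

lemma four_power_le_three_power_swap:
  fixes a b :: nat
  assumes "2 \<le> a" "3 * a \<le> b"
  shows "4 * b ^ a \<le> 3 * a ^ b"
  using assms(2)
proof (induction b rule: dec_induct)
  case base
  \<comment> \<open>At \<open>b = 3 * a\<close> a common factor \<open>a ^ a\<close> cancels,
    leaving this. For \<open>a = 2\<close> it reads 36 \<le> 48; otherwise 3 \<le> \<open>a\<close>
    gives room.\<close>
  have "4 * 3 ^ a \<le> 3 * a ^ (2 * a)"
  proof (cases "a = 2")
    case False
    with assms have "3 \<le> a" by simp
    then have "3 ^ (2 * a) \<le> a ^ (2 * a)" by (rule power_mono) simp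
    moreover have "4 \<le> (3::nat) * 3 ^ a"
      using power_increasing[of 1 a "3::nat"] assms by simp
    then have "4 * 3 ^ a \<le> (3 * 3 ^ a) * (3::nat) ^ a"
      by (rule mult_right_mono) simp
    then have "4 * 3 ^ a \<le> 3 * (3::nat) ^ (2 * a)"
      by (simp only: mult_2 power_add mult.assoc)
    ultimately show ?thesis
      by linarith
  qed simp
  then have "4 * 3 ^ a * a ^ a \<le> 3 * a ^ (2 * a) * a ^ a"
    by (rule mult_right_mono) simp
  moreover have "a ^ (3 * a) = a ^ (2 * a) * a ^ a"
    by (simp flip: power_add)
  ultimately show ?case
    by (simp add: power_mult_distrib mult.assoc)
next
  case (step b)
  have "4 * Suc b ^ a \<le> 4 * (2 * b ^ a)"
    using power_Suc_base_le_double[of a b] step.hyps by simp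
  also have "\<dots> = 2 * (4 * b ^ a)" by simp
  also have "\<dots> \<le> a * (3 * a ^ b)"
    using assms(1) step.IH by (rule mult_mono) auto
  finally show ?case by simp
qed

text \<open>Serves twice: as room in the exponent when absorbing the factor 4, and to exclude
  \<open>fact n = n\<close> when \<open>k = 1\<close>.\<close>

lemma add_two_le_fact:
  assumes "3 \<le> (n::nat)"
  shows "n + 2 \<le> fact n"
  using assms
proof (induction n rule: dec_induct)
  case base
  show ?case by (simp add: fact_numeral)
next
  case (step n)
  have "fact n < (fact (Suc n) :: nat)"
    using step.hyps by (intro fact_less_mono_nat) auto
  then show ?case using step.IH by linarith
qed

lemma fact_power_add_power_le:
  fixes k n :: nat
  assumes "2 \<le> k" "k < n"
  shows "(fact n :: nat) ^ (fact k :: nat) + k ^ n \<le> (fact k :: nat) ^ (fact n :: nat)"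
proof -
  define a b :: nat where "a = fact k" and "b = fact n"
  have ka: "k \<le> a" unfolding a_def by (rule fact_ge_self)
  have a2: "2 \<le> a" using ka assms by simp
  have b: "n + 2 \<le> b" unfolding b_def using assms by (intro add_two_le_fact) simp
  \<comment> \<open>Since \<open>k < n\<close>, \<open>fact n\<close> is at least
    \<open>fact (Suc k)\<close>, whose extra factor \<open>Suc k\<close> is at least 3.\<close>
  have "3 * a \<le> Suc k * a" using assms by (intro mult_right_mono) auto
  also have "\<dots> = fact (Suc k)" by (simp add: a_def)
  also have "\<dots> \<le> b" unfolding b_def using assms by (intro fact_mono) simp
  finally have "4 * b ^ a \<le> 3 * a ^ b"
    by (rule four_power_le_three_power_swap[OF a2])
  moreover have "4 * k ^ n \<le> a ^ b"
  proof -
    \<comment> \<open>The factor 4 is absorbed by \<open>a ^ 2\<close>, at the cost of two in the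
      exponent.\<close>
    have "(2::nat) ^ 2 * k ^ n \<le> a ^ 2 * a ^ n"
      using a2 ka by (intro mult_mono power_mono) auto
    also have "\<dots> = a ^ (n + 2)" by (simp add: power_add power2_eq_square)
    also have "\<dots> \<le> a ^ b" using a2 b by (intro power_increasing) auto
    finally show ?thesis by simp
  qed
  ultimately show ?thesis unfolding a_def b_def by linarith
qed

lemma fact_power_diff_eq_imp:
  fixes n k :: nat
  assumes "0 < k" "k < n"
    and eq: "(fact k :: int) ^ (fact n :: nat) - int k ^ n = (fact n :: int) ^ (fact k :: nat) - int n ^ k"
  shows "k = 1 \<and> n = 2"
proof (cases "k = 1")
  case True
  then have "int (fact n) = int n" using eq by simp
  then have "fact n = n" by (simp only: of_nat_eq_iff)
  then have "\<not> 3 \<le> n" using add_two_le_fact[of n] by auto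
  then show ?thesis using True assms by simp
next
  case False
  then have "fact n ^ fact k + k ^ n \<le> (fact k :: nat) ^ (fact n :: nat)"
    using assms by (intro fact_power_add_power_le) auto
  then have "int (fact n ^ fact k + k ^ n) \<le> int (fact k ^ fact n)"
    by (simp only: of_nat_le_iff)
  then have "(fact n :: int) ^ (fact k :: nat) + int k ^ n \<le> fact k ^ (fact n :: nat)"
    by simp
  \<comment> \<open>Makes the inequality strict, so the equation is contradictory for
    \<open>k\<close> \<ge> 2.\<close>
  moreover have "0 < int n ^ k" using assms by simp
  ultimately show ?thesis using eq by linarith
qed

theorem theorem1p1:
  fixes n k :: nat
  assumes "n > 0" and "k > 0"
  shows "(fact k :: int) ^ (fact n :: nat) - int k ^ n = (fact n :: int) ^ (fact k :: nat) - int n ^ k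
    \<longleftrightarrow> k = n \<or> (k, n) \<in> {(1, 2), (2, 1)}"
proof
  assume eq: "(fact k :: int) ^ (fact n :: nat) - int k ^ n = (fact n :: int) ^ (fact k :: nat) - int n ^ k"
  show "k = n \<or> (k, n) \<in> {(1, 2), (2, 1)}"
    \<comment> \<open>Exchanging \<open>k\<close> and \<open>n\<close> swaps the two sides, so
      \<open>eq[symmetric]\<close> covers \<open>n < k\<close>.\<close>
    using fact_power_diff_eq_imp[OF assms(2) _ eq] fact_power_diff_eq_imp[OF assms(1) _ eq[symmetric]]
    by (cases k n rule: linorder_cases) auto
qed auto

end
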